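(* Let $n,t\ge1$, $\varepsilon\in(0,1)$ and $m\ge 2t\,(2nt+\log(1/\varepsilon))$ (natural logarithm). Let $\vec A\in\mathbb Z_2^{m\times n}$ be uniformly random and let $\theta_1,\dots,\theta_m$ be i.i.d. uniform on $[0,2\pi)$, independent of $\vec A$. Then the distribution $\nu^{*m}$ of the random diagonal unitary $U=\exp\!\big(\mathrm i\sum_{i=1}^m\theta_i\bigotimes_{j=1}^nZ^{\vec A_{ij}}\big)$ is an $\varepsilon$-approximate diagonal $t$-design. The same conclusion holds if instead each $\theta_i$ is drawn i.i.d. uniformly from $\{2\pi k/q\}_{k=1}^{q}$ for an integer $q>2t$.
   Context: $Z^0=I$, $Z^1=Z$. Let $\mu_D$ be the Haar measure on the group $D(2^n)$ of diagonal $2^n\times 2^n$ unitaries (equivalently, diagonal entries $e^{\mathrm i\phi_x}$ with independent uniform $\phi_x\in[0,2\pi)$). For a distribution $\nu$ on unitaries, the $t$-th moment operator is the channel $\mathcal M^{(t)}_\nu(X)=\mathbb E_{U\sim\nu}[U^{\otimes t}XU^{\dagger\otimes t}]$. $\nu$ is an $\varepsilon$-approximate diagonal $t$-design if $\|\mathcal M^{(t)}_\nu-\mathcal M^{(t)}_{\mu_D}\|_\diamond\le\varepsilon$, where $\|\mathcal M-\mathcal N\|_\diamond=\max_{\ket\psi}\|(\mathcal M\otimes\mathrm{id})(\ket\psi\!\bra\psi)-(\mathcal N\otimes\mathrm{id})(\ket\psi\!\bra\psi)\|_1$ over pure states on the input space tensored with a copy of itself. *)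

theory Defs
  imports "HOL-Probability.Probability" "Jordan_Normal_Form.Char_Poly"
begin

definition dagger :: "complex mat \<Rightarrow> complex mat" where
  "dagger A = mat (dim_col A) (dim_row A) (\<lambda>(i,j). cnj (A $$ (j,i)))"

definition kron :: "complex mat \<Rightarrow> complex mat \<Rightarrow> complex mat" where
  "kron A B = mat (dim_row A * dim_row B) (dim_col A * dim_col B)
     (\<lambda>(i,j). A $$ (i div dim_row B, j div dim_col B) * B $$ (i mod dim_row B, j mod dim_col B))"

fun tensor_pow :: "complex mat \<Rightarrow> nat \<Rightarrow> complex mat" where
  "tensor_pow U 0 = 1\<^sub>m 1"
| "tensor_pow U (Suc k) = kron (tensor_pow U k) U"

definition mat_exp :: "complex mat \<Rightarrow> complex mat" where
  "mat_exp H = mat (dim_row H) (dim_col H) (\<lambda>(i,j). \<Sum>k. (H ^\<^sub>m k) $$ (i,j) / of_nat (fact k))"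

definition pauliZ :: "complex mat" where
  "pauliZ = mat 2 2 (\<lambda>(i,j). if i = j then (if i = 0 then 1 else -1) else 0)"

definition Zpow :: "bool \<Rightarrow> complex mat" where
  "Zpow b = (if b then pauliZ else 1\<^sub>m 2)"

fun zstring :: "(nat \<Rightarrow> bool) \<Rightarrow> nat \<Rightarrow> complex mat" where
  "zstring a 0 = 1\<^sub>m 1"
| "zstring a (Suc j) = kron (zstring a j) (Zpow (a j))"

text \<open>Trace norm = sum of singular values = sum of square roots of the eigenvalues
  (with multiplicity) of A^\<dagger> A.\<close>
definition trace_norm :: "complex mat \<Rightarrow> real" where
  "trace_norm A = (\<Sum>\<^sub># (image_mset (\<lambda>ev. sqrt (Re ev)) (proots (char_poly (dagger A * A)))))"

text \<open>A channel on D x D matrices is modelled as a function on complex matrices.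
  (M \<otimes> id) on (D*D) x (D*D) matrices, system index first: p = s * D + r.\<close>
definition ext_id :: "(complex mat \<Rightarrow> complex mat) \<Rightarrow> nat \<Rightarrow> complex mat \<Rightarrow> complex mat" where
  "ext_id M D \<rho> = mat (D*D) (D*D) (\<lambda>(p,q).
      M (mat D D (\<lambda>(s,s'). \<rho> $$ (s * D + p mod D, s' * D + q mod D))) $$ (p div D, q div D))"

definition proj :: "complex vec \<Rightarrow> complex mat" where
  "proj \<psi> = mat (dim_vec \<psi>) (dim_vec \<psi>) (\<lambda>(i,j). \<psi> $ i * cnj (\<psi> $ j))"

definition unit_vec :: "nat \<Rightarrow> complex vec \<Rightarrow> bool" where
  "unit_vec d \<psi> \<longleftrightarrow> dim_vec \<psi> = d \<and> (\<Sum>i<d. (cmod (\<psi> $ i))\<^sup>2) = 1"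

definition diamond_dist :: "nat \<Rightarrow> (complex mat \<Rightarrow> complex mat) \<Rightarrow> (complex mat \<Rightarrow> complex mat) \<Rightarrow> real" where
  "diamond_dist D M N = Sup {trace_norm (ext_id M D (proj \<psi>) - ext_id N D (proj \<psi>)) | \<psi>. unit_vec (D*D) \<psi>}"

text \<open>A distribution on unitaries is given as the push-forward of a probability space P
  under a map U; the t-th moment operator is the (entrywise) expectation
  E[U^{\<otimes>t} X U^{\<dagger>\<otimes>t}].\<close>
definition moment_op :: "'p measure \<Rightarrow> ('p \<Rightarrow> complex mat) \<Rightarrow> nat \<Rightarrow> complex mat \<Rightarrow> complex mat" where
  "moment_op P U t X = mat (dim_row X) (dim_col X) (\<lambda>(i,j).
      integral\<^sup>L P (\<lambda>p. (tensor_pow (U p) t * X * dagger (tensor_pow (U p) t)) $$ (i,j)))"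

text \<open>Haar measure on diagonal unitaries D(2^n): independent uniform phases.\<close>
definition phase_space :: "nat \<Rightarrow> (nat \<Rightarrow> real) measure" where
  "phase_space N = PiM {..<N} (\<lambda>_. uniform_measure lborel {0..<2*pi})"

definition diag_unitary :: "nat \<Rightarrow> (nat \<Rightarrow> real) \<Rightarrow> complex mat" where
  "diag_unitary n \<phi> = mat (2^n) (2^n) (\<lambda>(x,y). if x = y then exp (\<i> * of_real (\<phi> x)) else 0)"

definition haar_diag_moment :: "nat \<Rightarrow> nat \<Rightarrow> complex mat \<Rightarrow> complex mat" where
  "haar_diag_moment n t = moment_op (phase_space (2^n)) (diag_unitary n) t"

definition bool_matrices :: "nat \<Rightarrow> nat \<Rightarrow> (nat \<Rightarrow> nat \<Rightarrow> bool) set" where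
  "bool_matrices m n = {A. \<forall>i j. (i \<ge> m \<or> j \<ge> n) \<longrightarrow> A i j = False}"

definition circuit_unitary :: "nat \<Rightarrow> nat \<Rightarrow> (nat \<Rightarrow> nat \<Rightarrow> bool) \<times> (nat \<Rightarrow> real) \<Rightarrow> complex mat" where
  "circuit_unitary m n p = (case p of (A, \<theta>) \<Rightarrow>
     mat_exp (\<i> \<cdot>\<^sub>m (foldr (+) (map (\<lambda>i. complex_of_real (\<theta> i) \<cdot>\<^sub>m zstring (A i) n) [0..<m]) (0\<^sub>m (2^n) (2^n)))))"

definition circuit_space :: "nat \<Rightarrow> nat \<Rightarrow> real measure \<Rightarrow> ((nat \<Rightarrow> nat \<Rightarrow> bool) \<times> (nat \<Rightarrow> real)) measure" where
  "circuit_space m n \<Theta> = uniform_count_measure (bool_matrices m n) \<Otimes>\<^sub>M PiM {..<m} (\<lambda>_. \<Theta>)"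

definition circuit_moment :: "nat \<Rightarrow> nat \<Rightarrow> real measure \<Rightarrow> nat \<Rightarrow> complex mat \<Rightarrow> complex mat" where
  "circuit_moment m n \<Theta> t = moment_op (circuit_space m n \<Theta>) (circuit_unitary m n) t"

definition approx_diag_design :: "nat \<Rightarrow> nat \<Rightarrow> real \<Rightarrow> (complex mat \<Rightarrow> complex mat) \<Rightarrow> bool" where
  "approx_diag_design n t \<epsilon> M \<longleftrightarrow> diamond_dist ((2^n)^t) M (haar_diag_moment n t) \<le> \<epsilon>"

end

theory Submission
  imports Defs
begin

text \<open>
  Both moment operators act on X by multiplying each entry X(i,j) with a number depending only on
  the difference c of the multiplicities of the base-2^n digits of i and j. For Haar phases the
  number is 1 if c = 0 and 0 otherwise. For the random circuit it is p^m, where p is the probability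
  over a random bit vector a that the sum of c(x) (-1)^(a.x) vanishes: averaging over a phase kills
  every nonzero frequency of size at most 2t. If c is nonzero, this sum is an integer function of a,
  of absolute value at most 2t and with a nonzero integer Fourier coefficient, so p is at most
  1 - 1/(2t). On a pure state psi the difference of the two channels therefore has entries bounded
  by (1 - 1/(2t))^m |psi_p| |psi_q|; hence all its 4^(nt) singular values are at most
  (1 - 1/(2t))^m, and 4^(nt) exp(-m/(2t)) is at most epsilon.
\<close>

unbundle no vec_syntax

section \<open>Diagonal matrices: Kronecker products, tensor powers and exponentials\<close>

lemma dim_mat_diag [simp]: "dim_row (mat_diag N d) = N" "dim_col (mat_diag N d) = N"
  by (simp_all add: mat_diag_def)

lemma mat_diag_cong: "(\<And>i. i < N \<Longrightarrow> d i = e i) \<Longrightarrow> mat_diag N d = mat_diag N e"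
  by (rule eq_matI) (auto simp: mat_diag_def)

lemma kron_mat_diag:
  assumes "M > 0"
  shows "kron (mat_diag N d) (mat_diag M e) = mat_diag (N * M) (\<lambda>i. d (i div M) * e (i mod M))"
proof (rule eq_matI)
  fix i j assume "i < dim_row (mat_diag (N * M) (\<lambda>i. d (i div M) * e (i mod M)))"
    "j < dim_col (mat_diag (N * M) (\<lambda>i. d (i div M) * e (i mod M)))"
  then have ij: "i < N * M" "j < N * M" by auto
  have eq: "i = j \<longleftrightarrow> i div M = j div M \<and> i mod M = j mod M"
    by (metis div_mult_mod_eq)
  have "i div M < N" "j div M < N" using ij by (auto intro: less_mult_imp_div_less)
  moreover have "i mod M < M" "j mod M < M" using assms by auto
  ultimately show "kron (mat_diag N d) (mat_diag M e) $$ (i, j)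
      = mat_diag (N * M) (\<lambda>i. d (i div M) * e (i mod M)) $$ (i, j)"
    using ij eq by (auto simp: kron_def mat_diag_def)
qed (auto simp: kron_def)

text \<open>An index of a k-fold tensor power is a string of exactly k base-N digits, leading zeros
  included. For a diagonal matrix the entry of the tensor power depends only on how often each digit
  occurs.\<close>

fun digit_count :: "nat \<Rightarrow> nat \<Rightarrow> nat \<Rightarrow> nat \<Rightarrow> nat" where
  "digit_count N 0 i x = 0"
| "digit_count N (Suc k) i x = digit_count N k (i div N) x + (if i mod N = x then 1 else 0)"

lemma sum_digit_count: "N > 0 \<Longrightarrow> (\<Sum>x<N. digit_count N k i x) = k"
  by (induction k arbitrary: i) (auto simp: sum.distrib sum.delta)

lemma tensor_pow_mat_diag:
  assumes "N > 0"
  shows "tensor_pow (mat_diag N u) k = mat_diag (N ^ k) (\<lambda>i. \<Prod>x<N. u x ^ digit_count N k i x)"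
proof (induction k)
  case 0
  show ?case by (auto simp: mat_diag_def)
next
  case (Suc k)
  have "(\<Prod>x<N. u x ^ digit_count N (Suc k) i x)
      = (\<Prod>x<N. u x ^ digit_count N k (i div N) x) * u (i mod N)" for i
  proof -
    have "(\<Prod>x<N. u x ^ digit_count N (Suc k) i x)
        = (\<Prod>x<N. u x ^ digit_count N k (i div N) x * (if i mod N = x then u x else 1))"
      by (intro prod.cong) auto
    also have "\<dots> = (\<Prod>x<N. u x ^ digit_count N k (i div N) x) * (\<Prod>x<N. if i mod N = x then u x else 1)"
      by (rule prod.distrib)
    finally show ?thesis using assms by (simp add: prod.delta)
  qed
  then show ?case using Suc assms by (simp add: kron_mat_diag mult.commute)
qed

lemma pow_mat_diag: "mat_diag N d ^\<^sub>m k = mat_diag N (\<lambda>i. d i ^ k :: complex)"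
  by (induction k) (auto simp: mat_diag_diag mult.commute)

lemma mat_exp_mat_diag: "mat_exp (mat_diag N d) = mat_diag N (\<lambda>i. exp (d i))"
proof (rule eq_matI)
  fix i j assume "i < dim_row (mat_diag N (\<lambda>i. exp (d i)))" "j < dim_col (mat_diag N (\<lambda>i. exp (d i)))"
  then have ij: "i < N" "j < N" by auto
  have "(\<Sum>k. (if i = j then d j ^ k else 0) / of_nat (fact k)) = (if i = j then exp (d j) else 0)"
    by (auto simp: exp_def scaleR_conv_of_real divide_simps)
  then show "mat_exp (mat_diag N d) $$ (i, j) = mat_diag N (\<lambda>i. exp (d i)) $$ (i, j)"
    using ij by (simp add: mat_exp_def pow_mat_diag) (simp add: mat_diag_def)
qed (auto simp: mat_exp_def)

text \<open>The sign (-1)^(a.x), with bit a j paired with the j-th most significant of the n bits of x.\<close>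
fun zsign :: "(nat \<Rightarrow> bool) \<Rightarrow> nat \<Rightarrow> nat \<Rightarrow> int" where
  "zsign a 0 x = 1"
| "zsign a (Suc j) x = zsign a j (x div 2) * (if a j \<and> odd x then -1 else 1)"

lemma Zpow_eq_mat_diag: "Zpow b = mat_diag 2 (\<lambda>x. if b \<and> odd x then -1 else 1)"
  by (rule eq_matI) (auto simp: Zpow_def pauliZ_def mat_diag_def less_2_cases_iff)

lemma zstring_eq_mat_diag: "zstring a n = mat_diag (2 ^ n) (\<lambda>x. of_int (zsign a n x))"
proof (induction n)
  case 0
  show ?case by (auto simp: mat_diag_def)
next
  case (Suc n)
  then show ?case
    by (auto simp: Zpow_eq_mat_diag kron_mat_diag mult.commute mult.left_commute intro!: mat_diag_cong)
qed

lemma foldr_add_mat_diag: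
  "foldr (+) (map (\<lambda>i. mat_diag N (g i)) L) (0\<^sub>m N N) = mat_diag N (\<lambda>x. \<Sum>i\<leftarrow>L. g i x :: complex)"
  by (induction L) (auto simp: mat_diag_def)

text \<open>All Z strings are diagonal in the same basis, so the exponential acts on each diagonal
  entry separately.\<close>

lemma circuit_unitary_eq_mat_diag:
  "circuit_unitary m n (A, \<theta>)
    = mat_diag (2 ^ n) (\<lambda>x. exp (\<i> * of_real (\<Sum>i<m. \<theta> i * of_int (zsign (A i) n x))))"
proof -
  have smult: "c \<cdot>\<^sub>m mat_diag N d = mat_diag N (\<lambda>x. c * d x)" for c :: complex and N d
    by (rule eq_matI) (auto simp: mat_diag_def)
  show ?thesis
    by (simp add: circuit_unitary_def zstring_eq_mat_diag smult foldr_add_mat_diag mat_exp_mat_diag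
        interv_sum_list_conv_sum_set_nat atLeast0LessThan)
qed

lemma diag_unitary_eq_mat_diag: "diag_unitary n \<phi> = mat_diag (2 ^ n) (\<lambda>x. exp (\<i> * of_real (\<phi> x)))"
  by (rule eq_matI) (auto simp: diag_unitary_def mat_diag_def)

section \<open>Moment operators as entrywise multipliers\<close>

definition digit_diff :: "nat \<Rightarrow> nat \<Rightarrow> nat \<Rightarrow> nat \<Rightarrow> nat \<Rightarrow> int" where
  "digit_diff N t i j x = int (digit_count N t i x) - int (digit_count N t j x)"

text \<open>Both indices consist of t digits, so each family of counts sums to t. This is the source
  of the frequency limit 2t.\<close>

lemma sum_abs_digit_diff_le:
  assumes "N > 0" shows "(\<Sum>x<N. \<bar>digit_diff N t i j x\<bar>) \<le> 2 * int t"
proof -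
  have "(\<Sum>x<N. \<bar>digit_diff N t i j x\<bar>) \<le> (\<Sum>x<N. int (digit_count N t i x) + int (digit_count N t j x))"
    by (intro sum_mono) (auto simp: digit_diff_def)
  also have "\<dots> = int (\<Sum>x<N. digit_count N t i x) + int (\<Sum>x<N. digit_count N t j x)"
    by (simp add: sum.distrib)
  finally show ?thesis using sum_digit_count[OF assms] by simp
qed

text \<open>The characteristic function of the random phase vector at an integer frequency vector
  c.\<close>

definition phase_mean :: "'p measure \<Rightarrow> ('p \<Rightarrow> nat \<Rightarrow> real) \<Rightarrow> nat \<Rightarrow> (nat \<Rightarrow> int) \<Rightarrow> complex" where
  "phase_mean P \<phi> N c = integral\<^sup>L P (\<lambda>p. exp (\<i> * of_real (\<Sum>x<N. of_int (c x) * \<phi> p x)))"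

text \<open>Conjugation by a diagonal matrix scales the entry (i, j) by the i-th diagonal entry
  times the conjugate of the j-th one. The exponents subtract, which leaves the frequency vector
  \<open>digit_diff N t i j\<close>.\<close>

lemma index_moment_op_mat_diag:
  assumes "N > 0" and U: "\<And>p. U p = mat_diag N (\<lambda>x. exp (\<i> * of_real (\<phi> p x)))"
    and X: "X \<in> carrier_mat (N ^ t) (N ^ t)" and ij: "i < N ^ t" "j < N ^ t"
  shows "moment_op P U t X $$ (i, j) = X $$ (i, j) * phase_mean P \<phi> N (digit_diff N t i j)"
proof -
  define u where "u p i = (\<Prod>x<N. exp (\<i> * of_real (\<phi> p x)) ^ digit_count N t i x)" for p i
  have T: "tensor_pow (U p) t = mat_diag (N ^ t) (u p)" for p
    unfolding U u_def by (rule tensor_pow_mat_diag[OF assms(1)])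
  have dg: "dagger (mat_diag M d) = mat_diag M (\<lambda>i. cnj (d i))" for M d
    by (rule eq_matI) (auto simp: dagger_def mat_diag_def)
  have u: "u p i = exp (\<i> * of_real (\<Sum>x<N. of_nat (digit_count N t i x) * \<phi> p x))" for p i
    by (simp add: u_def exp_of_nat_mult[symmetric] exp_sum[symmetric] sum_distrib_left mult_ac)
  have "(tensor_pow (U p) t * X * dagger (tensor_pow (U p) t)) $$ (i, j) = u p i * X $$ (i, j) * cnj (u p j)" for p
  proof -
    have 1: "mat_diag (N ^ t) (u p) * X = Matrix.mat (N ^ t) (N ^ t) (\<lambda>(i, j). u p i * X $$ (i, j))"
      by (rule mat_diag_mult_left[OF X])
    show ?thesis unfolding T dg 1
      by (subst mat_diag_mult_right[of _ "N ^ t" "N ^ t"]) (use ij in auto)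
  qed
  also have "u p i * X $$ (i, j) * cnj (u p j)
      = X $$ (i, j) * exp (\<i> * of_real (\<Sum>x<N. of_int (digit_diff N t i j x) * \<phi> p x))" for p
    by (simp add: u exp_cnj exp_add[symmetric] digit_diff_def sum_subtractf algebra_simps
        flip: exp_minus)
  finally have "moment_op P U t X $$ (i, j) = integral\<^sup>L P
      (\<lambda>p. X $$ (i, j) * exp (\<i> * of_real (\<Sum>x<N. of_int (digit_diff N t i j x) * \<phi> p x)))"
    using X ij by (simp add: moment_op_def)
  then show ?thesis by (simp add: phase_mean_def)
qed

text \<open>The reference indices \<open>p mod D\<close> and \<open>q mod D\<close> only select a
  block, so the multiplier is determined by the system indices alone.\<close>

lemma index_ext_id_moment_op_mat_diag:
  assumes "N > 0" and U: "\<And>p. U p = mat_diag N (\<lambda>x. exp (\<i> * of_real (\<phi> p x)))"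
    and D: "D = N ^ t" and pq: "p < D * D" "q < D * D"
  shows "ext_id (moment_op P U t) D \<rho> $$ (p, q)
    = \<rho> $$ (p, q) * phase_mean P \<phi> N (digit_diff N t (p div D) (q div D))"
proof -
  have "p div D < D" "q div D < D" using pq by (auto intro: less_mult_imp_div_less)
  then show ?thesis using pq
    by (simp add: ext_id_def index_moment_op_mat_diag[OF assms(1) U] D[symmetric])
qed

section \<open>Trace norm of a matrix dominated entrywise by a pure state\<close>

text \<open>If v is an eigenvector of \<open>dagger A * A\<close> for k, then |Av|^2 = k |v|^2.
  Cauchy-Schwarz bounds the p-th entry of Av by \<delta> |\<psi> p| |v|, and summing the squares
  over p gives Re k at most \<delta>^2. So each of the N singular values is at most
  \<delta>.\<close>

lemma trace_norm_le:
  assumes A: "A \<in> carrier_mat N N" and \<psi>: "(\<Sum>i<N. (cmod (\<psi> i))\<^sup>2) = 1" and "\<delta> \<ge> 0"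
    and le: "\<And>p q. p < N \<Longrightarrow> q < N \<Longrightarrow> cmod (A $$ (p, q)) \<le> \<delta> * (cmod (\<psi> p) * cmod (\<psi> q))"
  shows "trace_norm A \<le> real N * \<delta>"
proof -
  let ?B = "dagger A * A"
  have dA: "dagger A \<in> carrier_mat N N" using A by (auto simp: dagger_def)
  then have B: "?B \<in> carrier_mat N N" using A by auto
  have ev: "sqrt (Re k) \<le> \<delta>" if "k \<in># proots (char_poly ?B)" for k
  proof -
    have "char_poly ?B \<noteq> 0" using degree_monic_char_poly[OF B] by auto
    then have "poly (char_poly ?B) k = 0" using that by simp
    then have "eigenvalue ?B k" using eigenvalue_root_char_poly[OF B] by simp
    then obtain v :: "complex vec" where v: "v \<in> carrier_vec N" "v \<noteq> 0\<^sub>v N" "?B *\<^sub>v v = k \<cdot>\<^sub>v v"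
      using B by (auto simp: eigenvalue_def eigenvector_def)
    define w where "w = A *\<^sub>v v"
    have w: "w \<in> carrier_vec N" using A v by (auto simp: w_def)
    have wi: "w $ p = (\<Sum>q<N. A $$ (p, q) * v $ q)" if "p < N" for p
      using that A v by (simp add: w_def scalar_prod_def atLeast0LessThan)
    have "dagger A *\<^sub>v w = k \<cdot>\<^sub>v v"
      using assoc_mult_mat_vec[OF dA A v(1)] v(3) by (simp only: w_def)
    then have kv: "k * v $ q = (\<Sum>p<N. cnj (A $$ (p, q)) * w $ p)" if "q < N" for q
    proof -
      have "k * v $ q = (dagger A *\<^sub>v w) $ q" using \<open>dagger A *\<^sub>v w = k \<cdot>\<^sub>v v\<close> that v(1) by auto
      also have "\<dots> = (\<Sum>p<N. cnj (A $$ (p, q)) * w $ p)"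
        using that A w by (auto simp: dagger_def scalar_prod_def atLeast0LessThan)
      finally show ?thesis .
    qed
    let ?S = "\<Sum>q<N. (cmod (v $ q))\<^sup>2"
    \<comment> \<open>The squared norm of w = Av is evaluated by moving A to the other side, where
      the eigenvalue equation \<open>kv\<close> applies.\<close>
    have "(\<Sum>p<N. w $ p * cnj (w $ p)) = (\<Sum>p<N. \<Sum>q<N. cnj (v $ q) * (cnj (A $$ (p, q)) * w $ p))"
    proof (intro sum.cong refl)
      fix p assume "p \<in> {..<N}"
      then have "cnj (w $ p) = (\<Sum>q<N. cnj (A $$ (p, q)) * cnj (v $ q))" by (simp add: wi)
      then show "w $ p * cnj (w $ p) = (\<Sum>q<N. cnj (v $ q) * (cnj (A $$ (p, q)) * w $ p))"
        by (simp only: sum_distrib_left mult_ac)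
    qed
    also have "\<dots> = (\<Sum>q<N. \<Sum>p<N. cnj (v $ q) * (cnj (A $$ (p, q)) * w $ p))"
      by (rule sum.swap)
    also have "\<dots> = (\<Sum>q<N. k * (v $ q * cnj (v $ q)))"
    proof (intro sum.cong refl)
      fix q assume "q \<in> {..<N}"
      then have "(\<Sum>p<N. cnj (v $ q) * (cnj (A $$ (p, q)) * w $ p)) = cnj (v $ q) * (k * v $ q)"
        by (simp add: kv sum_distrib_left)
      then show "(\<Sum>p<N. cnj (v $ q) * (cnj (A $$ (p, q)) * w $ p)) = k * (v $ q * cnj (v $ q))"
        by (simp add: mult_ac)
    qed
    finally have "(\<Sum>p<N. w $ p * cnj (w $ p)) = k * (\<Sum>q<N. v $ q * cnj (v $ q))"
      by (simp add: sum_distrib_left)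
    then have "complex_of_real (\<Sum>p<N. (cmod (w $ p))\<^sup>2) = k * complex_of_real ?S"
      by (simp only: of_real_sum complex_norm_square)
    \<comment> \<open>A priori k is complex. Both squared norms are real, so real parts give the
      identity for \<open>Re k\<close>, the quantity under the root in
      \<open>trace_norm\<close>.\<close>
    then have Re_k: "(\<Sum>p<N. (cmod (w $ p))\<^sup>2) = Re k * ?S"
      by (metis Re_complex_of_real times_complex.sel(1) Im_complex_of_real mult_zero_right diff_zero)
    have w_le: "(cmod (w $ p))\<^sup>2 \<le> (\<delta>\<^sup>2 * ?S) * (cmod (\<psi> p))\<^sup>2" if p: "p < N" for p
    proof -
      have "cmod (w $ p) \<le> (\<Sum>q<N. \<delta> * (cmod (\<psi> p) * cmod (\<psi> q)) * cmod (v $ q))"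
        unfolding wi[OF p] by (rule sum_norm_le) (auto simp: norm_mult intro!: mult_right_mono le p)
      also have "\<dots> = \<delta> * cmod (\<psi> p) * (\<Sum>q<N. cmod (\<psi> q) * cmod (v $ q))"
        by (simp add: sum_distrib_left mult_ac)
      finally have "(cmod (w $ p))\<^sup>2 \<le> (\<delta> * cmod (\<psi> p) * (\<Sum>q<N. cmod (\<psi> q) * cmod (v $ q)))\<^sup>2"
        by (rule power_mono) simp
      also have "\<dots> = \<delta>\<^sup>2 * (cmod (\<psi> p))\<^sup>2 * (\<Sum>q<N. cmod (\<psi> q) * cmod (v $ q))\<^sup>2"
        by (simp add: power_mult_distrib)
      also have "\<dots> \<le> \<delta>\<^sup>2 * (cmod (\<psi> p))\<^sup>2 * ((\<Sum>q<N. (cmod (\<psi> q))\<^sup>2) * ?S)"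
        by (intro mult_left_mono Cauchy_Schwarz_ineq_sum) auto
      finally show ?thesis by (simp add: \<psi> mult_ac)
    qed
    have "Re k * ?S \<le> (\<Sum>p<N. (\<delta>\<^sup>2 * ?S) * (cmod (\<psi> p))\<^sup>2)"
      unfolding Re_k[symmetric] by (rule sum_mono) (use w_le in auto)
    also have "\<dots> = \<delta>\<^sup>2 * ?S" by (simp add: \<psi> flip: sum_distrib_left)
    finally have le: "Re k * ?S \<le> \<delta>\<^sup>2 * ?S" .
    obtain q where "q < N" "v $ q \<noteq> 0"
      using v(1,2) by (metis carrier_vecD eq_vecI index_zero_vec(1) index_zero_vec(2))
    then have "?S > 0" by (intro sum_pos2[of _ q]) auto
    then have "Re k \<le> \<delta>\<^sup>2" using le by simp
    then show ?thesis using \<open>\<delta> \<ge> 0\<close> real_le_lsqrt real_sqrt_le_mono by fastforce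
  qed
  have "trace_norm A \<le> (\<Sum>k\<in>#proots (char_poly ?B). \<delta>)"
    unfolding trace_norm_def by (rule sum_mset_mono) (rule ev)
  also have "\<dots> = real (size (proots (char_poly ?B))) * \<delta>" by simp
  \<comment> \<open>Over the complex numbers the characteristic polynomial splits, so its roots with
    multiplicity are as many as its degree.\<close>
  also have "size (proots (char_poly ?B)) = N"
    using degree_monic_char_poly[OF B] by (simp add: size_proots_complex)
  finally show ?thesis .
qed

section \<open>Bit vectors and orthogonality of their characters\<close>

text \<open>The default value False beyond position n gives each vector exactly one representative,
  and matches the convention in \<open>bool_matrices\<close>.\<close>

definition bit_vectors :: "nat \<Rightarrow> (nat \<Rightarrow> bool) set" where
  "bit_vectors n = PiE_dflt {..<n} False (\<lambda>_. UNIV)"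

lemma finite_bit_vectors [simp]: "finite (bit_vectors n)"
  by (auto simp: bit_vectors_def)

lemma card_bit_vectors: "card (bit_vectors n) = 2 ^ n"
  by (simp add: bit_vectors_def card_PiE_dflt)

lemma bool_matrices_eq: "bool_matrices m n = PiE_dflt {..<m} (\<lambda>_. False) (\<lambda>_. bit_vectors n)"
  by (auto simp: bool_matrices_def bit_vectors_def PiE_dflt_def fun_eq_iff not_less)

lemma finite_bool_matrices [simp]: "finite (bool_matrices m n)"
  by (auto simp: bool_matrices_eq)

lemma card_bool_matrices: "card (bool_matrices m n) = (2 ^ n) ^ m"
  by (simp add: bool_matrices_eq card_PiE_dflt card_bit_vectors)

text \<open>A vector of length n already has False at position n, so it stands for its own extension
  by False; the update supplies the extension by True.\<close>

lemma sum_bit_vectors_Suc: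
  "(\<Sum>a\<in>bit_vectors (Suc n). f a) = (\<Sum>a\<in>bit_vectors n. f a + f (a(n := True)))"
proof -
  have split: "bit_vectors (Suc n) = bit_vectors n \<union> (\<lambda>a. a(n := True)) ` bit_vectors n"
  proof (intro equalityI subsetI)
    fix a assume a: "a \<in> bit_vectors (Suc n)"
    show "a \<in> bit_vectors n \<union> (\<lambda>a. a(n := True)) ` bit_vectors n"
    proof (cases "a n")
      case True
      then have "a = (a(n := False))(n := True)" by (auto simp: fun_eq_iff)
      moreover have "a(n := False) \<in> bit_vectors n"
        using a by (auto simp: bit_vectors_def PiE_dflt_def less_Suc_eq)
      ultimately show ?thesis by blast
    qed (use a in \<open>auto simp: bit_vectors_def PiE_dflt_def less_Suc_eq\<close>)
  qed (auto simp: bit_vectors_def PiE_dflt_def)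
  have last: "\<not> a n" if "a \<in> bit_vectors n" for a
    using that by (auto simp: bit_vectors_def PiE_dflt_def)
  have inj: "inj_on (\<lambda>a. a(n := True)) (bit_vectors n)"
  proof (rule inj_onI)
    fix a b assume ab: "a \<in> bit_vectors n" "b \<in> bit_vectors n" "a(n := True) = b(n := True)"
    show "a = b"
    proof
      fix j show "a j = b j"
        using ab(1,2) last[of a] last[of b] fun_cong[OF ab(3), of j] by (cases "j = n") auto
    qed
  qed
  have "bit_vectors n \<inter> (\<lambda>a. a(n := True)) ` bit_vectors n = {}"
    by (auto dest: last)
  then show ?thesis
    by (simp add: split sum.union_disjoint sum.reindex[OF inj] sum.distrib)
qed

lemma zsign_cong: "(\<And>j. j < n \<Longrightarrow> a j = b j) \<Longrightarrow> zsign a n x = zsign b n x"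
  by (induction n arbitrary: x) auto

lemma abs_zsign [simp]: "\<bar>zsign a n x\<bar> = 1"
  by (induction n arbitrary: x) (auto simp: abs_mult)

text \<open>Summing over the last bit produces the factor 1 + (-1)^(x+y), which is 2 for equal
  parities and 0 otherwise. The remaining bits see only \<open>x div 2\<close> and
  \<open>y div 2\<close>, so induction applies.\<close>

lemma zsign_orthogonal:
  assumes "x < 2 ^ n" "y < 2 ^ n"
  shows "(\<Sum>a\<in>bit_vectors n. zsign a n x * zsign a n y) = (if x = y then 2 ^ n else 0)"
  using assms
proof (induction n arbitrary: x y)
  case 0
  then show ?case using card_bit_vectors[of 0] by simp
next
  case (Suc n)
  have upd: "zsign (a(n := True)) n z = zsign a n z" for a z
    by (rule zsign_cong) auto
  have last: "\<not> a n" if "a \<in> bit_vectors n" for a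
    using that by (auto simp: bit_vectors_def PiE_dflt_def)
  have "x div 2 < 2 ^ n" "y div 2 < 2 ^ n" using Suc.prems by auto
  note IH = Suc.IH[OF this]
  let ?s = "\<lambda>z :: nat. if odd z then -1 else 1 :: int"
  have "(\<Sum>a\<in>bit_vectors (Suc n). zsign a (Suc n) x * zsign a (Suc n) y)
      = (\<Sum>a\<in>bit_vectors n. zsign a n (x div 2) * zsign a n (y div 2) * (1 + ?s x * ?s y))"
    unfolding sum_bit_vectors_Suc by (intro sum.cong refl) (auto simp: upd last)
  also have "\<dots> = (if x div 2 = y div 2 then 2 ^ n else 0) * (1 + ?s x * ?s y)"
    by (simp only: sum_distrib_right[symmetric] IH)
  also have "\<dots> = (if x = y then 2 ^ Suc n else 0)"
  proof (cases "x = y")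
    case False
    then have "x div 2 = y div 2 \<Longrightarrow> odd x \<noteq> odd y"
      by (metis dvd_mult_div_cancel odd_two_times_div_two_succ)
    then show ?thesis using False by auto
  qed auto
  finally show ?case .
qed

section \<open>Sign sums and how often they vanish\<close>

text \<open>The frequency at which the angle of a gate with bit vector a enters the phase belonging
  to c.\<close>

definition sign_sum :: "nat \<Rightarrow> (nat \<Rightarrow> int) \<Rightarrow> (nat \<Rightarrow> bool) \<Rightarrow> int" where
  "sign_sum n c a = (\<Sum>x<2 ^ n. c x * zsign a n x)"

lemma abs_sign_sum_le: "\<bar>sign_sum n c a\<bar> \<le> (\<Sum>x<2 ^ n. \<bar>c x\<bar>)"
  unfolding sign_sum_def by (rule order.trans[OF sum_abs]) (simp add: abs_mult)

text \<open>Fourier inversion on the group of bit vectors recovers the integer c y as the average of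
  the sign sum against a character, so the average of its absolute value is at least 1.\<close>
lemma card_sign_sum_nonzero_ge:
  assumes L: "(\<Sum>x<2 ^ n. \<bar>c x\<bar>) \<le> L" and y: "y < 2 ^ n" "c y \<noteq> 0"
  shows "2 ^ n \<le> L * int (card {a \<in> bit_vectors n. sign_sum n c a \<noteq> 0})"
proof -
  have "(\<Sum>a\<in>bit_vectors n. sign_sum n c a * zsign a n y)
      = (\<Sum>a\<in>bit_vectors n. \<Sum>x<2 ^ n. c x * (zsign a n x * zsign a n y))"
    by (simp add: sign_sum_def sum_distrib_right mult.assoc)
  also have "\<dots> = (\<Sum>x<2 ^ n. c x * (\<Sum>a\<in>bit_vectors n. zsign a n x * zsign a n y))"
    by (subst sum.swap) (simp add: sum_distrib_left)
  also have "\<dots> = (\<Sum>x<2 ^ n. if x = y then c x * 2 ^ n else 0)"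
    using y(1) by (intro sum.cong refl) (simp add: zsign_orthogonal)
  also have "\<dots> = c y * 2 ^ n" using y(1) by simp
  finally have "\<bar>c y\<bar> * 2 ^ n = \<bar>\<Sum>a\<in>bit_vectors n. sign_sum n c a * zsign a n y\<bar>"
    by (simp add: abs_mult)
  also have "\<dots> \<le> (\<Sum>a\<in>bit_vectors n. \<bar>sign_sum n c a\<bar>)"
    by (rule order.trans[OF sum_abs]) (simp add: abs_mult)
  also have "\<dots> = (\<Sum>a | a \<in> bit_vectors n \<and> sign_sum n c a \<noteq> 0. \<bar>sign_sum n c a\<bar>)"
    by (rule sum.mono_neutral_right) auto
  also have "\<dots> \<le> (\<Sum>a | a \<in> bit_vectors n \<and> sign_sum n c a \<noteq> 0. L)"
    by (intro sum_mono order.trans[OF abs_sign_sum_le L])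
  finally have "\<bar>c y\<bar> * 2 ^ n \<le> L * int (card {a \<in> bit_vectors n. sign_sum n c a \<noteq> 0})"
    by (simp add: mult.commute)
  moreover have "1 * 2 ^ n \<le> \<bar>c y\<bar> * (2 ^ n :: int)"
    using y(2) by (intro mult_right_mono) auto
  ultimately show ?thesis by linarith
qed

text \<open>The complement of the zero set has density at least 1/L by the preceding count. The
  bound on the density is the contraction factor contributed by one gate.\<close>

lemma fraction_sign_sum_zero_le:
  fixes L :: int
  assumes L: "(\<Sum>x<2 ^ n. \<bar>c x\<bar>) \<le> L" and y: "y < 2 ^ n" "c y \<noteq> 0"
  shows "real (card {a \<in> bit_vectors n. sign_sum n c a = 0}) / 2 ^ n \<le> 1 - 1 / L"
proof -
  have "0 < \<bar>c y\<bar>" using y by simp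
  also have "\<dots> \<le> (\<Sum>x<2 ^ n. \<bar>c x\<bar>)" using y by (intro member_le_sum) auto
  finally have "L > 0" using L by simp
  let ?Z = "{a \<in> bit_vectors n. sign_sum n c a = 0}" and ?Y = "{a \<in> bit_vectors n. sign_sum n c a \<noteq> 0}"
  have "card ?Z + card ?Y = card (?Z \<union> ?Y)"
    by (rule card_Un_disjoint[symmetric]) auto
  also have "?Z \<union> ?Y = bit_vectors n" by auto
  finally have "card ?Z + card ?Y = 2 ^ n" by (simp only: card_bit_vectors)
  then have "real (card ?Z + card ?Y) = real (2 ^ n)" by (simp only:)
  then have Z: "real (card ?Z) = 2 ^ n - real (card ?Y)" by simp
  have "2 ^ n \<le> of_int L * real (card ?Y)"
  proof -
    have "of_int (2 ^ n) \<le> (of_int (L * int (card ?Y)) :: real)"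
      using card_sign_sum_nonzero_ge[OF assms] by (simp only: of_int_le_iff)
    then show ?thesis by simp
  qed
  then show ?thesis unfolding Z using \<open>L > 0\<close> by (simp add: field_simps)
qed

section \<open>Averages over independent rows and phases\<close>

lemma sum_bool_matrices_prod:
  "(\<Sum>A\<in>bool_matrices m n. \<Prod>i<m. g (A i)) = (\<Sum>a\<in>bit_vectors n. g a :: 'a :: comm_semiring_1) ^ m"
proof -
  have "(\<Sum>A\<in>bool_matrices m n. \<Prod>i<m. g (A i)) = (\<Sum>A\<in>PiE {..<m} (\<lambda>_. bit_vectors n). \<Prod>i<m. g (A i))"
    unfolding bool_matrices_eq
    \<comment> \<open>The two encodings of m rows differ only at row indices from m on:
      \<open>undefined\<close> in the extensional functions, the zero row in the matrices.\<close>
    by (rule sum.reindex_bij_witness[where j = "\<lambda>A. restrict A {..<m}"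
          and i = "\<lambda>A i. if i < m then A i else (\<lambda>_. False)"])
      (auto simp: PiE_dflt_def PiE_def extensional_def fun_eq_iff)
  also have "\<dots> = (\<Prod>i<m. \<Sum>a\<in>bit_vectors n. g a)"
    by (subst prod_sum_PiE) auto
  finally show ?thesis by simp
qed

lemma integral_uniform_count_pair:
  fixes f :: "'a \<times> 'b \<Rightarrow> complex"
  assumes S: "finite S" "S \<noteq> {}" and "prob_space M"
    and f: "\<And>s. s \<in> S \<Longrightarrow> (\<lambda>y. f (s, y)) \<in> borel_measurable M" and B: "\<And>z. norm (f z) \<le> B"
  shows "integral\<^sup>L (uniform_count_measure S \<Otimes>\<^sub>M M) f = (\<Sum>s\<in>S. integral\<^sup>L M (\<lambda>y. f (s, y))) / of_nat (card S)"
proof -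
  interpret M: prob_space M by fact
  interpret S: prob_space "uniform_count_measure S" by (rule prob_space_uniform_count_measure[OF S])
  interpret P: pair_prob_space "uniform_count_measure S" M ..
  \<comment> \<open>Over a countable discrete factor, joint measurability reduces to that of the
    sections.\<close>
  have "f \<in> borel_measurable (count_space S \<Otimes>\<^sub>M M)"
    by (rule measurable_pair_measure_countable1) (use S f in \<open>auto intro: countable_finite\<close>)
  also have "borel_measurable (count_space S \<Otimes>\<^sub>M M) = borel_measurable (uniform_count_measure S \<Otimes>\<^sub>M M)"
    by (intro measurable_cong_sets sets_pair_measure_cong) (auto simp: sets_uniform_count_measure_count_space)
  finally have "integrable (uniform_count_measure S \<Otimes>\<^sub>M M) f"
    by (intro P.integrable_const_bound[where B = B]) (use B in auto)
  then have "integral\<^sup>L (uniform_count_measure S \<Otimes>\<^sub>M M) f = (\<integral>s. \<integral>y. f (s, y) \<partial>M \<partial>uniform_count_measure S)"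
    by (rule P.integral_fst'[symmetric])
  also have "\<dots> = (\<Sum>s\<in>S. integral\<^sup>L M (\<lambda>y. f (s, y))) / of_nat (card S)"
    using S by (simp add: uniform_count_measure_def lebesgue_integral_point_measure_finite
        sum_divide_distrib scaleR_conv_of_real)
  finally show ?thesis .
qed

text \<open>All that is asked of the angle distribution: up to frequency L its Fourier coefficients
  are those of a uniform phase. Both distributions of the theorem satisfy this for L = 2t. The
  measurability clause allows a \<sigma>-algebra other than the Borel one, such as the discrete one
  on a finite set.\<close>

definition kills_frequencies :: "real measure \<Rightarrow> int \<Rightarrow> bool" where
  "kills_frequencies \<Theta> L \<longleftrightarrow> prob_space \<Theta> \<and> (\<lambda>\<theta>. \<theta>) \<in> borel_measurable \<Theta> \<and>
     (\<forall>k. \<bar>k\<bar> \<le> L \<longrightarrow> integral\<^sup>L \<Theta> (\<lambda>\<theta>. exp (\<i> * of_real (of_int k * \<theta>))) = (if k = 0 then 1 else 0))"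

lemma integral_PiM_phases:
  assumes \<Theta>: "kills_frequencies \<Theta> L" and I: "finite I" and k: "\<And>i. i \<in> I \<Longrightarrow> \<bar>k i\<bar> \<le> L"
  shows "integral\<^sup>L (PiM I (\<lambda>_. \<Theta>)) (\<lambda>\<theta>. exp (\<i> * of_real (\<Sum>i\<in>I. of_int (k i) * \<theta> i)))
    = (\<Prod>i\<in>I. if k i = 0 then 1 else 0)"
proof -
  interpret \<Theta>: prob_space \<Theta> using \<Theta> by (simp add: kills_frequencies_def)
  interpret product_prob_space "\<lambda>_. \<Theta>" I ..
  have [measurable]: "(\<lambda>\<theta>. \<theta>) \<in> borel_measurable \<Theta>" using \<Theta> by (simp add: kills_frequencies_def)
  have "integral\<^sup>L (PiM I (\<lambda>_. \<Theta>)) (\<lambda>\<theta>. exp (\<i> * of_real (\<Sum>i\<in>I. of_int (k i) * \<theta> i)))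
      = integral\<^sup>L (PiM I (\<lambda>_. \<Theta>)) (\<lambda>\<theta>. \<Prod>i\<in>I. exp (\<i> * of_real (of_int (k i) * \<theta> i)))"
    using I by (simp add: sum_distrib_left exp_sum)
  also have "\<dots> = (\<Prod>i\<in>I. integral\<^sup>L \<Theta> (\<lambda>\<theta>. exp (\<i> * of_real (of_int (k i) * \<theta>))))"
    by (rule product_integral_prod[OF I]) (rule \<Theta>.integrable_const_bound[where B = 1]; simp add: norm_exp_eq_Re)
  also have "\<dots> = (\<Prod>i\<in>I. if k i = 0 then 1 else 0)"
    using \<Theta> k by (intro prod.cong refl) (auto simp: kills_frequencies_def)
  finally show ?thesis .
qed

text \<open>Exchanging sums gives the angle of gate i the frequency
  \<open>sign_sum n c (A i)\<close>, at most L in absolute value. Averaging over the angles leaves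
  the indicator that all m frequencies vanish, and independence of the rows makes its mean an m-th
  power.\<close>

lemma phase_mean_circuit:
  assumes \<Theta>: "kills_frequencies \<Theta> L" and c: "(\<Sum>x<2 ^ n. \<bar>c x\<bar>) \<le> L"
  shows "phase_mean (circuit_space m n \<Theta>) (\<lambda>(A, \<theta>) x. \<Sum>i<m. \<theta> i * of_int (zsign (A i) n x)) (2 ^ n) c
    = of_real ((real (card {a \<in> bit_vectors n. sign_sum n c a = 0}) / 2 ^ n) ^ m)"
proof -
  let ?M = "PiM {..<m} (\<lambda>_. \<Theta>)" and ?f = "\<lambda>(A, \<theta>). exp (\<i> * of_real (\<Sum>i<m. of_int (sign_sum n c (A i)) * \<theta> i))"
  interpret prob_space \<Theta> using \<Theta> by (simp add: kills_frequencies_def)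
  interpret product_prob_space "\<lambda>_. \<Theta>" "{..<m}" ..
  have [measurable]: "(\<lambda>\<theta>. \<theta>) \<in> borel_measurable \<Theta>" using \<Theta> by (simp add: kills_frequencies_def)
  have M: "prob_space ?M" by (rule P.prob_space_axioms)
  have "(\<Sum>x<2 ^ n. of_int (c x) * (\<Sum>i<m. \<theta> i * of_int (zsign (A i) n x)))
      = (\<Sum>i<m. of_int (sign_sum n c (A i)) * \<theta> i :: real)" for A :: "nat \<Rightarrow> nat \<Rightarrow> bool" and \<theta>
    unfolding sum_distrib_left
    by (subst sum.swap) (simp add: sign_sum_def sum_distrib_left sum_distrib_right mult_ac)
  then have "phase_mean (circuit_space m n \<Theta>) (\<lambda>(A, \<theta>) x. \<Sum>i<m. \<theta> i * of_int (zsign (A i) n x)) (2 ^ n) c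
      = integral\<^sup>L (uniform_count_measure (bool_matrices m n) \<Otimes>\<^sub>M ?M) ?f"
    by (simp add: phase_mean_def circuit_space_def case_prod_unfold)
  also have "\<dots> = (\<Sum>A\<in>bool_matrices m n. integral\<^sup>L ?M (\<lambda>\<theta>. ?f (A, \<theta>))) / of_nat (card (bool_matrices m n))"
  proof (rule integral_uniform_count_pair[OF finite_bool_matrices _ M, where B = 1])
    show "bool_matrices m n \<noteq> {}" by (auto simp: bool_matrices_def)
    show "(\<lambda>\<theta>. ?f (A, \<theta>)) \<in> borel_measurable ?M" for A by simp
  qed (auto simp: case_prod_unfold)
  also have "(\<lambda>A. integral\<^sup>L ?M (\<lambda>\<theta>. ?f (A, \<theta>))) = (\<lambda>A. \<Prod>i<m. if sign_sum n c (A i) = 0 then 1 else 0)"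
    unfolding prod.case
    by (intro ext integral_PiM_phases[OF \<Theta>]) (auto intro: order.trans[OF abs_sign_sum_le c])
  also have "(\<Sum>A\<in>bool_matrices m n. \<Prod>i<m. if sign_sum n c (A i) = 0 then 1 else 0 :: complex)
      = of_nat (card {a \<in> bit_vectors n. sign_sum n c a = 0}) ^ m"
    by (simp add: sum_bool_matrices_prod[where g = "\<lambda>a. if sign_sum n c a = 0 then 1 else 0"] sum.If_cases Int_def)
  finally show ?thesis by (simp add: card_bool_matrices power_divide)
qed

section \<open>Fourier coefficients of the two angle distributions\<close>

lemma kills_frequencies_uniform: "kills_frequencies (uniform_measure lborel {0..<2 * pi}) L"
proof -
  have "integral\<^sup>L (uniform_measure lborel {0..<2 * pi}) (\<lambda>\<theta>. exp (\<i> * of_real (of_int k * \<theta>)))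
      = (if k = 0 then 1 else 0)" for k
  proof -
    let ?f = "\<lambda>\<theta> :: real. exp (\<i> * of_real (of_int k * \<theta>))"
    have "(\<lambda>x. indicator {0..<2 * pi} x / emeasure lborel {0..<2 * pi}) = (\<lambda>x. ennreal (indicator {0..<2 * pi} x / (2 * pi)))"
      by (auto simp: fun_eq_iff indicator_def divide_ennreal[symmetric] ennreal_mult)
    then have "integral\<^sup>L (uniform_measure lborel {0..<2 * pi}) ?f
        = integral\<^sup>L lborel (\<lambda>x. (indicator {0..<2 * pi} x / (2 * pi)) *\<^sub>R ?f x)"
      unfolding uniform_measure_def by (simp add: integral_density)
    \<comment> \<open>The endpoint 2 pi is a null set; the closed interval is what the fundamental
      theorem of calculus expects.\<close>
    also have "\<dots> = integral\<^sup>L lborel (\<lambda>x. indicator {0..2 * pi} x *\<^sub>R (?f x / of_real (2 * pi)))"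
      by (rule integral_cong_AE)
        (use AE_lborel_singleton[of "2 * pi"] in \<open>auto simp: indicator_def scaleR_conv_of_real elim!: eventually_mono\<close>)
    also have "\<dots> = (if k = 0 then 1 else 0)"
    proof (cases "k = 0")
      case True
      have "integral\<^sup>L lborel (\<lambda>x. indicator {0..2 * pi} x *\<^sub>R (?f x / of_real (2 * pi)))
          = of_real (2 * pi / (2 * pi)) - of_real (0 / (2 * pi))"
        by (rule integral_FTC_atLeastAtMost)
          (auto simp: True intro!: derivative_eq_intros continuous_intros)
      then show ?thesis using True by simp
    next
      case False
      let ?F = "\<lambda>x :: real. ?f x / (\<i> * of_int k * of_real (2 * pi))"
      have "integral\<^sup>L lborel (\<lambda>x. indicator {0..2 * pi} x *\<^sub>R (?f x / of_real (2 * pi))) = ?F (2 * pi) - ?F 0"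
      proof (rule integral_FTC_atLeastAtMost)
        fix x
        show "(?F has_vector_derivative ?f x / of_real (2 * pi)) (at x within {0..2 * pi})"
        proof -
          \<comment> \<open>The antiderivative is differentiated as a holomorphic function and then
            restricted to the real line.\<close>
          have "((\<lambda>z. exp (\<i> * (of_int k * z)) / (\<i> * of_int k * of_real (2 * pi)))
              has_field_derivative ?f x / of_real (2 * pi)) (at (of_real x))"
            using False by (auto intro!: derivative_eq_intros)
          from has_vector_derivative_real_field[OF this] show ?thesis
            by (simp only: of_real_mult of_real_of_int_eq)
        qed
      qed (auto intro!: continuous_intros)
      \<comment> \<open>Since k is an integer, the antiderivative is periodic and its boundary
        values cancel.\<close>
      moreover have "?f (2 * pi) = 1"
        by (subst exp_eq_1) auto
      ultimately show ?thesis using False by simp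
    qed
    finally show ?thesis .
  qed
  moreover have "prob_space (uniform_measure lborel {0..<2 * pi})"
    by (rule prob_space_uniform_measure) auto
  ultimately show ?thesis by (simp add: kills_frequencies_def)
qed

text \<open>The mean is a geometric sum over powers of w = exp(2 pi i k / q), which vanishes unless
  w = 1, that is, unless q divides k. As |k| is less than q, only k = 0 remains.\<close>

lemma kills_frequencies_roots_of_unity:
  assumes "L < int q" "q > 0"
  shows "kills_frequencies (uniform_count_measure {2 * pi * real k / real q |k. k \<in> {1..q}}) L"
proof -
  let ?g = "\<lambda>j. 2 * pi * real j / real q"
  have S: "{2 * pi * real k / real q |k. k \<in> {1..q}} = ?g ` {1..q}" by auto
  have inj: "inj_on ?g {1..q}" using assms(2) by (auto simp: inj_on_def)
  have "integral\<^sup>L (uniform_count_measure (?g ` {1..q})) (\<lambda>\<theta>. exp (\<i> * of_real (of_int k * \<theta>)))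
      = (if k = 0 then 1 else 0)" if k: "\<bar>k\<bar> \<le> L" for k
  proof -
    define w where "w = exp (\<i> * of_real (of_int k * (2 * pi / real q)))"
    have w: "exp (\<i> * of_real (of_int k * ?g j)) = w ^ j" for j
      by (simp add: w_def exp_of_nat_mult[symmetric] mult_ac)
    have "integral\<^sup>L (uniform_count_measure (?g ` {1..q})) (\<lambda>\<theta>. exp (\<i> * of_real (of_int k * \<theta>)))
        = (\<Sum>j\<in>{1..q}. w ^ j) / of_nat q"
      unfolding uniform_count_measure_def
      by (subst lebesgue_integral_point_measure_finite)
        (simp_all only: card_image[OF inj] sum.reindex[OF inj] o_def w, auto simp: scaleR_conv_of_real sum_divide_distrib)
    also have "(\<Sum>j\<in>{1..q}. w ^ j) = w * (\<Sum>j<q. w ^ j)"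
      by (simp add: sum_distrib_left sum.atLeast1_atMost_eq)
    also have "w * (\<Sum>j<q. w ^ j) = (if k = 0 then of_nat q else 0)"
    proof (cases "k = 0")
      case False
      have "w ^ q = exp (\<i> * of_real (of_int k * ?g q))" by (rule w[symmetric])
      also have "\<dots> = 1" using assms(2) by (subst exp_eq_1) auto
      finally have "w ^ q = 1" .
      moreover have "w \<noteq> 1"
      proof
        assume "w = 1"
        then obtain l :: int where "of_int k * (2 * pi / real q) = of_int (2 * l) * pi"
          unfolding w_def exp_eq_1 by auto
        then have "of_int k = (of_int (l * int q) :: real)"
          using assms(2) by (simp add: field_simps)
        then have "k = l * int q" by (simp only: of_int_eq_iff)
        then show False using False k assms(1)
          by (metis dvd_triv_right dvd_imp_le_int abs_of_nat leD order.strict_trans1 of_nat_0_le_iff abs_ge_self)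
      qed
      ultimately show ?thesis using False by (simp add: geometric_sum)
    qed (simp add: w_def)
    finally show ?thesis using assms(2) by simp
  qed
  moreover have "prob_space (uniform_count_measure (?g ` {1..q}))"
    using assms(2) by (intro prob_space_uniform_count_measure) auto
  ultimately show ?thesis
    unfolding S by (simp add: kills_frequencies_def measurable_cong_sets[OF sets_uniform_count_measure_count_space refl])
qed

section \<open>Comparison of the circuit with Haar phases\<close>

lemma phase_mean_haar:
  "phase_mean (phase_space N) (\<lambda>\<phi>. \<phi>) N c = (if \<forall>x<N. c x = 0 then 1 else 0)"
proof -
  have "phase_mean (phase_space N) (\<lambda>\<phi>. \<phi>) N c = (\<Prod>x<N. if c x = 0 then 1 else 0)"
    unfolding phase_mean_def phase_space_def
    \<comment> \<open>The continuous uniform phase kills every nonzero frequency, so the limit can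
      be taken as large as c demands.\<close>
    by (rule integral_PiM_phases[OF kills_frequencies_uniform[of "\<Sum>x<N. \<bar>c x\<bar>"]])
      (auto intro: member_le_sum)
  then show ?thesis by (auto simp: prod_zero_iff)
qed

text \<open>For c = 0 both means equal 1. Otherwise the Haar mean is 0 and the circuit mean is the
  m-th power of a fraction of at most 1 - 1/L.\<close>

lemma phase_mean_circuit_haar_dist:
  assumes \<Theta>: "kills_frequencies \<Theta> L" and c: "(\<Sum>x<2 ^ n. \<bar>c x\<bar>) \<le> L" and "L \<ge> 1"
  shows "cmod (phase_mean (circuit_space m n \<Theta>) (\<lambda>(A, \<theta>) x. \<Sum>i<m. \<theta> i * of_int (zsign (A i) n x)) (2 ^ n) c
      - phase_mean (phase_space (2 ^ n)) (\<lambda>\<phi>. \<phi>) (2 ^ n) c) \<le> (1 - 1 / L) ^ m"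
proof (cases "\<forall>x<2 ^ n. c x = 0")
  case True
  then have "sign_sum n c a = 0" for a by (simp add: sign_sum_def)
  then show ?thesis using True \<open>L \<ge> 1\<close>
    by (simp add: phase_mean_haar phase_mean_circuit[OF \<Theta> c] card_bit_vectors)
next
  case False
  then obtain y where y: "y < 2 ^ n" "c y \<noteq> 0" by auto
  let ?r = "real (card {a \<in> bit_vectors n. sign_sum n c a = 0}) / 2 ^ n"
  have "?r ^ m \<le> (1 - 1 / L) ^ m"
    by (rule power_mono[OF fraction_sign_sum_zero_le[OF c y]]) simp
  moreover have "cmod (of_real (?r ^ m)) = ?r ^ m" by (simp only: norm_of_real) simp
  ultimately show ?thesis using False
    by (simp only: phase_mean_haar phase_mean_circuit[OF \<Theta> c] if_False diff_zero)
qed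

text \<open>The entries of \<open>proj \<psi>\<close> have modulus |\<psi> p| |\<psi> q|, so
  \<open>trace_norm_le\<close> applies with the amplitudes of the input state as weights, in
  dimension D * D.\<close>

lemma diamond_dist_circuit_haar_le:
  assumes \<Theta>: "kills_frequencies \<Theta> (2 * int t)" and "t \<ge> 1" and D: "D = (2 ^ n) ^ t"
  shows "diamond_dist D (circuit_moment m n \<Theta> t) (haar_diag_moment n t)
    \<le> real (D * D) * (1 - 1 / (2 * real t)) ^ m"
  unfolding diamond_dist_def
proof (rule cSup_least)
  \<comment> \<open>A basis state shows that the supremum runs over a nonempty set.\<close>
  let ?\<psi> = "Matrix.vec (D * D) (\<lambda>i. if i = 0 then 1 else 0) :: complex vec"
  have "(\<Sum>i<D * D. (cmod (?\<psi> $ i))\<^sup>2) = (\<Sum>i<D * D. if i = 0 then 1 else 0)"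
    by (intro sum.cong) auto
  also have "\<dots> = 1" using D by (subst sum.delta) auto
  finally have "Defs.unit_vec (D * D) ?\<psi>" by (simp add: Defs.unit_vec_def)
  then show "{trace_norm (ext_id (circuit_moment m n \<Theta> t) D (proj \<psi>) - ext_id (haar_diag_moment n t) D (proj \<psi>))
      |\<psi>. Defs.unit_vec (D * D) \<psi>} \<noteq> {}" by blast
next
  fix r assume "r \<in> {trace_norm (ext_id (circuit_moment m n \<Theta> t) D (proj \<psi>) - ext_id (haar_diag_moment n t) D (proj \<psi>))
      |\<psi>. Defs.unit_vec (D * D) \<psi>}"
  then obtain \<psi> :: "complex vec" where \<psi>: "Defs.unit_vec (D * D) \<psi>"
    and r: "r = trace_norm (ext_id (circuit_moment m n \<Theta> t) D (proj \<psi>) - ext_id (haar_diag_moment n t) D (proj \<psi>))"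
    by blast
  let ?C = "ext_id (circuit_moment m n \<Theta> t) D (proj \<psi>)" and ?H = "ext_id (haar_diag_moment n t) D (proj \<psi>)"
  let ?\<delta> = "(1 - 1 / (2 * real t)) ^ m"
  let ?c = "\<lambda>p q. digit_diff (2 ^ n) t (p div D) (q div D)"
  let ?\<phi> = "\<lambda>(A :: nat \<Rightarrow> nat \<Rightarrow> bool, \<theta>) x. \<Sum>i<m. \<theta> i * of_int (zsign (A i) n x)"
  have dim: "dim_vec \<psi> = D * D" using \<psi> by (simp add: Defs.unit_vec_def)
  show "r \<le> real (D * D) * ?\<delta>"
    unfolding r
  proof (rule trace_norm_le[where \<psi> = "\<lambda>i. \<psi> $ i"])
    show "?C - ?H \<in> carrier_mat (D * D) (D * D)" by (auto simp: ext_id_def)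
    show "(\<Sum>i<D * D. (cmod (\<psi> $ i))\<^sup>2) = 1" using \<psi> by (simp add: Defs.unit_vec_def)
    show "?\<delta> \<ge> 0" using \<open>t \<ge> 1\<close> by simp
    fix p q assume pq: "p < D * D" "q < D * D"
    have C: "?C $$ (p, q) = proj \<psi> $$ (p, q) * phase_mean (circuit_space m n \<Theta>) ?\<phi> (2 ^ n) (?c p q)"
      unfolding circuit_moment_def
      by (rule index_ext_id_moment_op_mat_diag[OF _ _ D pq])
        (auto simp: circuit_unitary_eq_mat_diag case_prod_unfold split: prod.split)
    have H: "?H $$ (p, q) = proj \<psi> $$ (p, q) * phase_mean (phase_space (2 ^ n)) (\<lambda>\<phi>. \<phi>) (2 ^ n) (?c p q)"
      unfolding haar_diag_moment_def
      by (rule index_ext_id_moment_op_mat_diag[OF _ _ D pq]) (auto simp: diag_unitary_eq_mat_diag)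
    have "(?C - ?H) $$ (p, q) = ?C $$ (p, q) - ?H $$ (p, q)"
      using pq by (intro index_minus_mat) (auto simp: ext_id_def)
    also have "\<dots> = proj \<psi> $$ (p, q) * (phase_mean (circuit_space m n \<Theta>) ?\<phi> (2 ^ n) (?c p q)
        - phase_mean (phase_space (2 ^ n)) (\<lambda>\<phi>. \<phi>) (2 ^ n) (?c p q))"
      unfolding C H by (simp add: algebra_simps)
    also have "cmod \<dots> \<le> cmod (proj \<psi> $$ (p, q)) * (1 - 1 / real_of_int (2 * int t)) ^ m"
      unfolding norm_mult
      by (intro mult_left_mono phase_mean_circuit_haar_dist[OF \<Theta>] sum_abs_digit_diff_le)
        (use \<open>t \<ge> 1\<close> in auto)
    also have "\<dots> = ?\<delta> * (cmod (\<psi> $ p) * cmod (\<psi> $ q))"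
      using pq dim by (simp add: proj_def norm_mult)
    finally show "cmod ((?C - ?H) $$ (p, q)) \<le> ?\<delta> * (cmod (\<psi> $ p) * cmod (\<psi> $ q))" .
  qed
qed

text \<open>The hypothesis on m makes exp(-m/(2t)) at most \<epsilon> exp(-2nt), and the second
  factor absorbs the dimension D * D = 2^(2nt).\<close>

lemma approx_diag_design_circuit:
  assumes \<Theta>: "kills_frequencies \<Theta> (2 * int t)" and "t \<ge> 1" and "0 < \<epsilon>"
    and m: "real m \<ge> 2 * real t * (2 * real n * real t + ln (1 / \<epsilon>))"
  shows "approx_diag_design n t \<epsilon> (circuit_moment m n \<Theta> t)"
proof -
  let ?D = "(2 ^ n) ^ t :: nat"
  have "1 - 1 / (2 * real t) \<le> exp (- (1 / (2 * real t)))"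
    using exp_ge_add_one_self[of "- (1 / (2 * real t))"] by simp
  then have "(1 - 1 / (2 * real t)) ^ m \<le> exp (- (1 / (2 * real t))) ^ m"
    using \<open>t \<ge> 1\<close> by (intro power_mono) auto
  also have "\<dots> = exp (- (real m / (2 * real t)))" by (simp flip: exp_of_nat_mult)
  also have "\<dots> \<le> exp (- (2 * real n * real t + ln (1 / \<epsilon>)))"
    using m \<open>t \<ge> 1\<close> by (simp add: field_simps)
  also have "\<dots> = \<epsilon> * exp (- (2 * real n * real t))"
    using \<open>0 < \<epsilon>\<close> by (simp add: exp_add exp_minus ln_div exp_diff divide_inverse)
  finally have power_le: "(1 - 1 / (2 * real t)) ^ m \<le> \<epsilon> * exp (- (2 * real n * real t))" .
  have "real (?D * ?D) = 2 ^ (2 * (n * t))" by (simp add: power_mult[symmetric] power_add[symmetric] mult_2)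
  also have "\<dots> \<le> exp 1 ^ (2 * (n * t))"
    \<comment> \<open>The inequality 1 + x \<le> exp x at x = 1 yields 2 \<le> e.\<close>
    using exp_ge_add_one_self[of 1] by (intro power_mono) auto
  also have "\<dots> = exp (2 * real n * real t)" by (simp flip: exp_of_nat_mult add: mult_ac)
  finally have D_le: "real (?D * ?D) \<le> exp (2 * real n * real t)" .
  have "diamond_dist ?D (circuit_moment m n \<Theta> t) (haar_diag_moment n t)
      \<le> real (?D * ?D) * (1 - 1 / (2 * real t)) ^ m"
    by (rule diamond_dist_circuit_haar_le[OF \<Theta> \<open>t \<ge> 1\<close> refl])
  also have "\<dots> \<le> exp (2 * real n * real t) * (\<epsilon> * exp (- (2 * real n * real t)))"
    using D_le power_le \<open>t \<ge> 1\<close> by (intro mult_mono) auto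
  also have "\<dots> = \<epsilon>" by (simp add: exp_minus)
  finally show ?thesis by (simp add: approx_diag_design_def)
qed

theorem mainTheorem4:
  fixes n t m :: nat and \<epsilon> :: real
  assumes "n \<ge> 1" and "t \<ge> 1" and "0 < \<epsilon>" and "\<epsilon> < 1"
    and "real m \<ge> 2 * real t * (2 * real n * real t + ln (1 / \<epsilon>))"
  shows "approx_diag_design n t \<epsilon>
           (circuit_moment m n (uniform_measure lborel {0..<2*pi}) t)
       \<and> (\<forall>q::nat. q > 2 * t \<longrightarrow> approx_diag_design n t \<epsilon>
           (circuit_moment m n (uniform_count_measure {2 * pi * real k / real q | k. k \<in> {1..q}}) t))"
proof (intro conjI allI impI)
  show "approx_diag_design n t \<epsilon> (circuit_moment m n (uniform_measure lborel {0..<2*pi}) t)"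
    by (rule approx_diag_design_circuit[OF kills_frequencies_uniform]) (use assms in auto)
  fix q :: nat assume "q > 2 * t"
  then show "approx_diag_design n t \<epsilon>
      (circuit_moment m n (uniform_count_measure {2 * pi * real k / real q | k. k \<in> {1..q}}) t)"
    by (intro approx_diag_design_circuit[OF kills_frequencies_roots_of_unity]) (use assms in auto)
qed

end
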